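(* Let $H$ be a bipartite graph with $v$ vertices and $e$ edges, where $v\le e$. Set $s:=\frac{2e}{v}$ and $s':=\frac{2e}{2e-v}$. Assume that for every nonnegative symmetric matrix $W$, $$\hom(H,W)\ge \|W\|_{s'\to s}^{\,e}.$$ Let $\operatorname{sub}(H)$ be the graph obtained by subdividing every edge of $H$ once. Then $\operatorname{sub}(H)$ satisfies the operator-norm Sidorenko certificate. More precisely, for every graph $G$ with adjacency matrix $A=A(G)$, $$\hom(\operatorname{sub}(H),G)\ge \|A\|_{\sigma'\to\sigma}^{\,2e},\qquad\text{where } \sigma=\frac{4e}{v+e},\quad \sigma'=\frac{4e}{3e-v}.$$
   Context: Graphs are finite and simple, with nonempty vertex set. $\hom(H,G)$ is the number of homomorphisms from $H$ to $G$. For an entrywise nonnegative real symmetric matrix $W=(w_{ij})_{i,j\in[n]}$, $\hom(H,W):=\sum_{\phi:V(H)\to[n]}\prod_{uv\in E(H)}w_{\phi(u)\phi(v)}$. For a real $n\times n$ matrix $A$ and $1\le p,r\le\infty$, $\|A\|_{p\to r}:=\sup_{x\ne0}\|Ax\|_r/\|x\|_p$, with the usual $\ell^p$ norms on $\mathbb R^n$. Operator-norm Sidorenko certificate: a bipartite graph $F$ with $v_F$ vertices and $e_F$ edges, $v_F\le e_F$, satisfies it if for every graph $G$ with adjacency matrix $A$, $\hom(F,G)\ge\|A\|_{s_F'\to s_F}^{e_F}$, where $s_F=\frac{2e_F}{v_F}$ and $s_F'=\frac{2e_F}{2e_F-v_F}$. *)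

theory Defs
  imports
    "HOL-Library.Extended_Real"
    "HOL-Library.FuncSet"
    "Jordan_Normal_Form.Matrix"
begin

record 'a ugraph =
  gverts :: "'a set"
  gedges :: "'a set set"

definition simple_graph :: "'a ugraph \<Rightarrow> bool" where
  "simple_graph G \<longleftrightarrow> finite (gverts G) \<and> gverts G \<noteq> {} \<and>
     (\<forall>e\<in>gedges G. \<exists>u\<in>gverts G. \<exists>v\<in>gverts G. u \<noteq> v \<and> e = {u, v})"

definition bipartite_graph :: "'a ugraph \<Rightarrow> bool" where
  "bipartite_graph G \<longleftrightarrow> simple_graph G \<and>
     (\<exists>X Y. X \<union> Y = gverts G \<and> X \<inter> Y = {} \<and>
        (\<forall>e\<in>gedges G. \<exists>x\<in>X. \<exists>y\<in>Y. e = {x, y}))"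

abbreviation num_verts :: "'a ugraph \<Rightarrow> nat" where
  "num_verts G \<equiv> card (gverts G)"

abbreviation num_edges :: "'a ugraph \<Rightarrow> nat" where
  "num_edges G \<equiv> card (gedges G)"

text \<open>The vertex \<open>Inr e\<close> of the subdivision is the new vertex placed on the edge \<open>e\<close>.\<close>

definition subdivision :: "'a ugraph \<Rightarrow> ('a + 'a set) ugraph" where
  "subdivision H = \<lparr>gverts = gverts H <+> gedges H,
     gedges = {{Inl u, Inr e} | u e. e \<in> gedges H \<and> u \<in> e}\<rparr>"

definition graph_homs :: "'a ugraph \<Rightarrow> 'b ugraph \<Rightarrow> ('a \<Rightarrow> 'b) set" where
  "graph_homs H G = {\<phi> \<in> gverts H \<rightarrow>\<^sub>E gverts G.
     \<forall>u v. {u, v} \<in> gedges H \<longrightarrow> {\<phi> u, \<phi> v} \<in> gedges G}"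

definition hom_count :: "'a ugraph \<Rightarrow> 'b ugraph \<Rightarrow> nat" where
  "hom_count H G = card (graph_homs H G)"

text \<open>
  The factor \<open>w\<^bsub>\<phi>(u)\<phi>(v)\<^esub>\<close> of an unordered edge \<open>{u, v}\<close>. It does not depend on the order of the
  endpoints, and the description is therefore proper, when the matrix is symmetric.
\<close>

definition edge_weight :: "real mat \<Rightarrow> ('a \<Rightarrow> nat) \<Rightarrow> 'a set \<Rightarrow> real" where
  "edge_weight W \<phi> e = (THE w. \<exists>u v. e = {u, v} \<and> w = W $$ (\<phi> u, \<phi> v))"

lemma edge_weight_eq:
  assumes "W \<in> carrier_mat n n" "transpose_mat W = W" "\<phi> u < n" "\<phi> v < n"
  shows "edge_weight W \<phi> {u, v} = W $$ (\<phi> u, \<phi> v)"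
proof -
  have "W $$ (\<phi> v, \<phi> u) = transpose_mat W $$ (\<phi> u, \<phi> v)"
    using assms(1,3,4) by simp
  then have "W $$ (\<phi> v, \<phi> u) = W $$ (\<phi> u, \<phi> v)"
    using assms(2) by simp
  then show ?thesis
    unfolding edge_weight_def by (intro the_equality) (auto simp: doubleton_eq_iff)
qed

definition hom_mat :: "'a ugraph \<Rightarrow> real mat \<Rightarrow> real" where
  "hom_mat H W = (\<Sum>\<phi> \<in> gverts H \<rightarrow>\<^sub>E {..<dim_row W}. \<Prod>e\<in>gedges H. edge_weight W \<phi> e)"

definition nonneg_sym_mat :: "nat \<Rightarrow> real mat \<Rightarrow> bool" where
  "nonneg_sym_mat n W \<longleftrightarrow> W \<in> carrier_mat n n \<and> transpose_mat W = W \<and>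
     (\<forall>i<n. \<forall>j<n. 0 \<le> W $$ (i, j))"

text \<open>
  Adjacency matrices are taken with respect to an enumeration of the vertices, so that a graph has
  one for every such enumeration.
\<close>

definition adjacency_matrix :: "'a ugraph \<Rightarrow> real mat \<Rightarrow> bool" where
  "adjacency_matrix G A \<longleftrightarrow>
     (\<exists>f. bij_betw f {..<num_verts G} (gverts G) \<and>
        A = mat (num_verts G) (num_verts G)
              (\<lambda>(i, j). if {f i, f j} \<in> gedges G then 1 else 0))"

definition lp_norm :: "ereal \<Rightarrow> real vec \<Rightarrow> real" where
  "lp_norm p x =
     (if p = \<infinity> then Max ((\<lambda>i. \<bar>x $ i\<bar>) ` {..<dim_vec x})
      else (\<Sum>i<dim_vec x. \<bar>x $ i\<bar> powr real_of_ereal p) powr (1 / real_of_ereal p))"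

text \<open>Meaningful for a matrix with at least one column and for \<open>1 \<le> p, r \<le> \<infinity>\<close>.\<close>

definition op_norm :: "ereal \<Rightarrow> ereal \<Rightarrow> real mat \<Rightarrow> real" where
  "op_norm p r A =
     (SUP x \<in> carrier_vec (dim_col A) - {0\<^sub>v (dim_col A)}. lp_norm r (A *\<^sub>v x) / lp_norm p x)"

text \<open>
  The graphs \<open>G\<close> that a certificate ranges over have their vertices in the type given by the first
  argument.
\<close>

definition opnorm_sidorenko_certificate :: "'b itself \<Rightarrow> 'a ugraph \<Rightarrow> bool" where
  "opnorm_sidorenko_certificate _ F \<longleftrightarrow>
     bipartite_graph F \<and> num_verts F \<le> num_edges F \<and>
     (let v = real (num_verts F); e = real (num_edges F); s = 2 * e / v; s' = 2 * e / (2 * e - v) in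
        \<forall>(G :: 'b ugraph) A. simple_graph G \<longrightarrow> adjacency_matrix G A \<longrightarrow>
          real (hom_count F G) \<ge> op_norm (ereal s') (ereal s) A ^ num_edges F)"

end

theory Submission
  imports Defs "HOL-Analysis.Convex"
begin

text \<open>
  Homomorphisms from the subdivision of \<open>H\<close> to \<open>G\<close> are counted by \<open>hom(H, A\<^sup>2)\<close>, since the entries of
  \<open>A\<^sup>2\<close> are the codegrees of \<open>G\<close>. With \<open>K\<close> the norm of \<open>A\<^sup>2\<close> from \<open>s'\<close> to \<open>s\<close>, it remains to bound the square
  of the norm of \<open>A\<close> from \<open>\<sigma>'\<close> to \<open>\<sigma>\<close> by \<open>K\<close>. As \<open>A\<close> is symmetric and \<open>s\<close>, \<open>s'\<close> are dual, Hoelder's inequality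
  gives \<open>\<langle>Ax, Ax\<rangle> = \<langle>x, A\<^sup>2x\<rangle> \<le> K \<parallel>x\<parallel>\<^sup>2\<close> in the norm of exponent \<open>s'\<close>. So \<open>A\<close> has norm at most \<open>\<surd>K\<close>
  from \<open>s'\<close> to 2 and, by duality, from 2 to \<open>s\<close>; the pair \<open>\<sigma>'\<close>, \<open>\<sigma>\<close> is the interpolation
  midpoint of these two.
\<close>

section \<open>Inequalities for finite sums: Hoelder, Cauchy--Schwarz, interpolation and
  duality\<close>

lemma Holder_sum:
  fixes f g :: "'i \<Rightarrow> real"
  assumes I: "finite I" and pq: "p > 1" "q > 1" "1 / p + 1 / q = 1"
    and f: "\<And>i. i \<in> I \<Longrightarrow> 0 \<le> f i" and g: "\<And>i. i \<in> I \<Longrightarrow> 0 \<le> g i"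
  shows "(\<Sum>i\<in>I. f i * g i) \<le> (\<Sum>i\<in>I. f i powr p) powr (1 / p) * (\<Sum>i\<in>I. g i powr q) powr (1 / q)"
proof -
  define M where "M = (\<Sum>i\<in>I. f i powr p)"
  define N where "N = (\<Sum>i\<in>I. g i powr q)"
  show ?thesis
  \<comment> \<open>The normalisation below divides by both norms. If one of them vanishes, then
    \<open>f\<close> or \<open>g\<close> is zero on \<open>I\<close>, and so is the left-hand
    side.\<close>
  proof (cases "M = 0 \<or> N = 0")
    case True
    then have "(\<forall>i\<in>I. f i = 0) \<or> (\<forall>i\<in>I. g i = 0)"
      unfolding M_def N_def using I by (simp add: sum_nonneg_eq_0_iff)
    then have "(\<Sum>i\<in>I. f i * g i) = 0"
      by (intro sum.neutral) auto
    then show ?thesis by simp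
  next
    case False
    have "M \<ge> 0" "N \<ge> 0" unfolding M_def N_def by (auto intro: sum_nonneg)
    with False have MN: "M > 0" "N > 0" by auto
    define a where "a = M powr (1 / p)"
    define b where "b = N powr (1 / q)"
    have ab: "a > 0" "b > 0" "a powr p = M" "b powr q = N"
      using MN pq by (auto simp: a_def b_def powr_powr)
    \<comment> \<open>After scaling both functions to norm 1, Young's inequality applied termwise
      sums to \<open>1 / p + 1 / q = 1\<close>.\<close>
    have "(\<Sum>i\<in>I. (f i / a) * (g i / b)) \<le> (\<Sum>i\<in>I. (f i / a) powr p / p + (g i / b) powr q / q)"
      using f g ab pq by (intro sum_mono Youngs_inequality) auto
    also have "\<dots> = (\<Sum>i\<in>I. f i powr p / M / p + g i powr q / N / q)"
      using f g ab by (intro sum.cong refl) (auto simp: powr_divide)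
    also have "\<dots> = M / M / p + N / N / q"
      by (simp add: sum.distrib flip: M_def N_def sum_divide_distrib)
    also have "\<dots> = 1" using MN pq by simp
    finally have "(\<Sum>i\<in>I. f i * g i) / (a * b) \<le> 1"
      by (simp add: sum_divide_distrib)
    then show ?thesis using ab
      by (simp add: a_def b_def M_def N_def divide_le_eq)
  qed
qed

lemma sum_mult_le_sqrt:
  fixes f g :: "'i \<Rightarrow> real"
  assumes "(\<Sum>i\<in>I. (f i)\<^sup>2) \<le> F" and "(\<Sum>i\<in>I. (g i)\<^sup>2) \<le> G"
  shows "(\<Sum>i\<in>I. f i * g i) \<le> sqrt F * sqrt G"
proof -
  have "0 \<le> (\<Sum>i\<in>I. (f i)\<^sup>2)" "0 \<le> (\<Sum>i\<in>I. (g i)\<^sup>2)" by (auto intro: sum_nonneg)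
  have "(\<Sum>i\<in>I. f i * g i)\<^sup>2 \<le> (\<Sum>i\<in>I. (f i)\<^sup>2) * (\<Sum>i\<in>I. (g i)\<^sup>2)"
    by (rule Cauchy_Schwarz_ineq_sum)
  also have "\<dots> \<le> F * G"
    using assms \<open>0 \<le> (\<Sum>i\<in>I. (f i)\<^sup>2)\<close> \<open>0 \<le> (\<Sum>i\<in>I. (g i)\<^sup>2)\<close> by (intro mult_mono) auto
  finally show ?thesis
    by (metis real_le_rsqrt real_sqrt_mult)
qed

text \<open>The T*T argument: symmetry turns the pairing of \<open>Ax\<close> with itself into that
  of \<open>x\<close> with \<open>A\<^sup>2x\<close>, and Hoelder's inequality brings in the bound
  on \<open>A\<^sup>2x\<close>. That bound is required only at the given \<open>x\<close>.\<close>

lemma square_bound_of_symmetric_kernel: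
  fixes a :: "'i \<Rightarrow> 'i \<Rightarrow> real" and x :: "'i \<Rightarrow> real"
  assumes I: "finite I" and p: "p > 1" "q > 1" "1 / p + 1 / q = 1"
    and a: "\<And>i j. i \<in> I \<Longrightarrow> j \<in> I \<Longrightarrow> 0 \<le> a i j" and sym: "\<And>i j. i \<in> I \<Longrightarrow> j \<in> I \<Longrightarrow> a i j = a j i"
    and x: "\<And>i. i \<in> I \<Longrightarrow> 0 \<le> x i"
    and K: "(\<Sum>i\<in>I. (\<Sum>j\<in>I. (\<Sum>k\<in>I. a i k * a k j) * x j) powr q) powr (1 / q)
      \<le> K * (\<Sum>i\<in>I. x i powr p) powr (1 / p)"
  shows "(\<Sum>i\<in>I. (\<Sum>j\<in>I. a i j * x j)\<^sup>2) \<le> K * ((\<Sum>i\<in>I. x i powr p) powr (1 / p))\<^sup>2"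
proof -
  let ?N = "(\<Sum>i\<in>I. x i powr p) powr (1 / p)"
  have "(\<Sum>i\<in>I. (\<Sum>j\<in>I. a i j * x j)\<^sup>2) = (\<Sum>k\<in>I. \<Sum>i\<in>I. \<Sum>j\<in>I. a k i * x i * (a k j * x j))"
    by (simp add: power2_eq_square sum_product)
  also have "\<dots> = (\<Sum>i\<in>I. \<Sum>j\<in>I. \<Sum>k\<in>I. a k i * x i * (a k j * x j))"
    by (subst sum.swap, rule sum.cong[OF refl], rule sum.swap)
  \<comment> \<open>Rewriting \<open>a k i\<close> as \<open>a i k\<close> makes the inner sum over
    \<open>k\<close> an entry of the squared kernel.\<close>
  also have "\<dots> = (\<Sum>i\<in>I. x i * (\<Sum>j\<in>I. (\<Sum>k\<in>I. a i k * a k j) * x j))"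
    unfolding sum_distrib_left sum_distrib_right
    by (intro sum.cong refl) (simp add: sym mult_ac)
  also have "\<dots> \<le> ?N * (\<Sum>i\<in>I. (\<Sum>j\<in>I. (\<Sum>k\<in>I. a i k * a k j) * x j) powr q) powr (1 / q)"
    using I p x a by (intro Holder_sum) (auto intro!: sum_nonneg mult_nonneg_nonneg)
  also have "\<dots> \<le> ?N * (K * ?N)"
    by (intro mult_left_mono K) auto
  finally show ?thesis by (simp add: power2_eq_square mult_ac)
qed

text \<open>
  The midpoint case of Riesz--Thorin: with \<open>f = x\<^sup>r\<^sup>/\<^sup>2\<close> and \<open>g = x\<^sup>r\<^sup>/\<^sup>p\<close> one has \<open>x = \<surd>(f g)\<close>, and pairing
  the \<open>f\<close> of each argument with the \<open>g\<close> of the other makes a single Cauchy--Schwarz step suffice.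
\<close>

lemma bilinear_interpolation:
  fixes a :: "'i \<Rightarrow> 'i \<Rightarrow> real" and x y :: "'i \<Rightarrow> real"
  assumes p: "p > 0" and r: "r > 0" "1 / r = 1 / 4 + 1 / (2 * p)" and K0: "K \<ge> 0"
    and a: "\<And>i j. i \<in> I \<Longrightarrow> j \<in> I \<Longrightarrow> 0 \<le> a i j" and sym: "\<And>i j. i \<in> I \<Longrightarrow> j \<in> I \<Longrightarrow> a i j = a j i"
    and K: "\<And>z. (\<And>i. i \<in> I \<Longrightarrow> 0 \<le> z i) \<Longrightarrow>
      (\<Sum>i\<in>I. (\<Sum>j\<in>I. a i j * z j)\<^sup>2) \<le> K * ((\<Sum>i\<in>I. z i powr p) powr (1 / p))\<^sup>2"
    and x: "\<And>i. i \<in> I \<Longrightarrow> 0 \<le> x i" and y: "\<And>i. i \<in> I \<Longrightarrow> 0 \<le> y i"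
  shows "(\<Sum>i\<in>I. y i * (\<Sum>j\<in>I. a i j * x j))
    \<le> sqrt K * (\<Sum>i\<in>I. x i powr r) powr (1 / r) * (\<Sum>i\<in>I. y i powr r) powr (1 / r)"
proof -
  define X where "X = (\<Sum>i\<in>I. x i powr r)"
  define Y where "Y = (\<Sum>i\<in>I. y i powr r)"
  have XY: "X \<ge> 0" "Y \<ge> 0" unfolding X_def Y_def by (auto intro: sum_nonneg)
  have half: "(\<Sum>i\<in>I. u i powr (r / 2) * (\<Sum>j\<in>I. a i j * w j powr (r / p)))
      \<le> sqrt (\<Sum>i\<in>I. u i powr r) * (sqrt K * (\<Sum>i\<in>I. w i powr r) powr (1 / p))"
    (is "?L u w \<le> _") if "\<And>i. i \<in> I \<Longrightarrow> 0 \<le> u i" for u w :: "'i \<Rightarrow> real"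
  proof -
    have "?L u w \<le> sqrt (\<Sum>i\<in>I. u i powr r) * sqrt (K * ((\<Sum>i\<in>I. w i powr r) powr (1 / p))\<^sup>2)"
    proof (rule sum_mult_le_sqrt)
      show "(\<Sum>i\<in>I. (u i powr (r / 2))\<^sup>2) \<le> (\<Sum>i\<in>I. u i powr r)"
        by (simp add: power2_eq_square powr_add[symmetric])
      have "(\<Sum>i\<in>I. (w i powr (r / p)) powr p) = (\<Sum>i\<in>I. w i powr r)"
        using p by (simp add: powr_powr)
      then show "(\<Sum>i\<in>I. (\<Sum>j\<in>I. a i j * w j powr (r / p))\<^sup>2) \<le> K * ((\<Sum>i\<in>I. w i powr r) powr (1 / p))\<^sup>2"
        using K[of "\<lambda>i. w i powr (r / p)"] by simp
    qed
    then show ?thesis by (simp add: real_sqrt_mult)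
  qed
  \<comment> \<open>The relation between \<open>r\<close> and \<open>p\<close> says exactly that
    \<open>r / 4 + r / (2 * p) = 1\<close>.\<close>
  have split: "t = sqrt (t powr (r / 2)) * sqrt (t powr (r / p))" if "t \<ge> 0" for t :: real
  proof -
    have "r / 2 / 2 + r / p / 2 = r * (1 / r)" unfolding r(2) by (simp add: field_simps)
    then have "r / 2 / 2 + r / p / 2 = 1" using r(1) by simp
    then show ?thesis
      using that by (simp add: powr_half_sqrt[symmetric] powr_powr powr_add[symmetric] field_simps)
  qed
  define T1 where "T1 = (\<Sum>i\<in>I. y i powr (r / 2) * (\<Sum>j\<in>I. a i j * x j powr (r / p)))"
  define T2 where "T2 = (\<Sum>i\<in>I. x i powr (r / 2) * (\<Sum>j\<in>I. a i j * y j powr (r / p)))"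
  have "(\<Sum>i\<in>I. y i * (\<Sum>j\<in>I. a i j * x j)) = (\<Sum>(i, j)\<in>I \<times> I. y i * a i j * x j)"
    by (simp add: sum_distrib_left sum.cartesian_product mult_ac)
  also have "\<dots> = (\<Sum>(i, j)\<in>I \<times> I. sqrt (a i j * (y i powr (r / 2) * x j powr (r / p)))
      * sqrt (a i j * (x j powr (r / 2) * y i powr (r / p))))"
  proof (rule sum.cong[OF refl], clarify)
    fix i j assume "i \<in> I" "j \<in> I"
    have "sqrt (a i j) * sqrt (a i j) = a i j" using a \<open>i \<in> I\<close> \<open>j \<in> I\<close> by simp
    then have "y i * a i j * x j = (sqrt (y i powr (r / 2)) * sqrt (y i powr (r / p)))
        * (sqrt (a i j) * sqrt (a i j)) * (sqrt (x j powr (r / 2)) * sqrt (x j powr (r / p)))"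
      by (simp only: split[OF x[OF \<open>j \<in> I\<close>], symmetric] split[OF y[OF \<open>i \<in> I\<close>], symmetric])
    then show "y i * a i j * x j = sqrt (a i j * (y i powr (r / 2) * x j powr (r / p)))
        * sqrt (a i j * (x j powr (r / 2) * y i powr (r / p)))"
      by (simp only: real_sqrt_mult mult_ac)
  qed
  also have "\<dots> \<le> sqrt T1 * sqrt T2"
  \<comment> \<open>The square sums of the two factors are \<open>T1\<close> and \<open>T2\<close>.
    In \<open>T2\<close> the roles of \<open>x\<close> and \<open>y\<close> are exchanged, so the
    kernel appears transposed and symmetry is needed.\<close>
  proof -
    have "(\<Sum>z\<in>I \<times> I. (case z of (i, j) \<Rightarrow> sqrt (a i j * (y i powr (r / 2) * x j powr (r / p))))\<^sup>2)
        = (\<Sum>(i, j)\<in>I \<times> I. a i j * (y i powr (r / 2) * x j powr (r / p)))"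
      by (rule sum.cong) (auto simp: a)
    also have "\<dots> = T1"
      by (simp add: T1_def sum_distrib_left sum.cartesian_product[symmetric] mult_ac)
    finally have 1: "(\<Sum>z\<in>I \<times> I. (case z of (i, j) \<Rightarrow>
      sqrt (a i j * (y i powr (r / 2) * x j powr (r / p))))\<^sup>2) = T1" .
    have "(\<Sum>z\<in>I \<times> I. (case z of (i, j) \<Rightarrow> sqrt (a i j * (x j powr (r / 2) * y i powr (r / p))))\<^sup>2)
        = (\<Sum>(i, j)\<in>I \<times> I. a i j * (x j powr (r / 2) * y i powr (r / p)))"
      by (rule sum.cong) (auto simp: a)
    also have "\<dots> = (\<Sum>j\<in>I. \<Sum>i\<in>I. a i j * (x j powr (r / 2) * y i powr (r / p)))"
      unfolding sum.cartesian_product[symmetric] by (rule sum.swap)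
    also have "\<dots> = T2"
      unfolding T2_def sum_distrib_left by (intro sum.cong refl) (simp add: sym mult_ac)
    finally have 2: "(\<Sum>z\<in>I \<times> I. (case z of (i, j) \<Rightarrow>
      sqrt (a i j * (x j powr (r / 2) * y i powr (r / p))))\<^sup>2) = T2" .
    show ?thesis
      using sum_mult_le_sqrt[OF eq_refl[OF 1] eq_refl[OF 2]]
      by (simp add: case_prod_unfold)
  qed
  also have "\<dots> \<le> sqrt (sqrt Y * (sqrt K * X powr (1 / p))) * sqrt (sqrt X * (sqrt K * Y powr (1 / p)))"
  proof (intro mult_mono real_sqrt_le_mono)
    show "T1 \<le> sqrt Y * (sqrt K * X powr (1 / p))"
      unfolding T1_def X_def Y_def by (rule half) (rule y)
    show "T2 \<le> sqrt X * (sqrt K * Y powr (1 / p))"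
      unfolding T2_def X_def Y_def by (rule half) (rule x)
    show "0 \<le> sqrt T2" using a unfolding T2_def by (auto intro!: sum_nonneg mult_nonneg_nonneg)
  qed (use XY K0 in auto)
  also have "\<dots> = sqrt K * X powr (1 / r) * Y powr (1 / r)"
  \<comment> \<open>Each of \<open>X\<close> and \<open>Y\<close> collects the exponent 1/4 from the
    double root and \<open>1 / (2 * p)\<close> from the other factor, hence \<open>1 / r\<close> in
    total.\<close>
  proof -
    have "sqrt (sqrt t) * sqrt (t powr (1 / p)) = t powr (1 / r)" if "t \<ge> 0" for t :: real
      using that by (simp add: powr_half_sqrt[symmetric] powr_powr powr_add[symmetric] r(2) mult.commute)
    note XY' = this[OF XY(1), symmetric] this[OF XY(2), symmetric]
    have "sqrt K = sqrt (sqrt K) * sqrt (sqrt K)" using K0 by simp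
    then have "sqrt K * X powr (1 / r) * Y powr (1 / r) = (sqrt (sqrt K) * sqrt (sqrt K))
        * (sqrt (sqrt X) * sqrt (X powr (1 / p))) * (sqrt (sqrt Y) * sqrt (Y powr (1 / p)))"
      by (simp only: XY')
    then show ?thesis
      by (simp only: real_sqrt_mult mult_ac)
  qed
  finally show ?thesis unfolding X_def Y_def .
qed

text \<open>The converse of Hoelder's inequality. The extremal test vector is
  \<open>y = b powr (q - 1)\<close>: its pairing with \<open>b\<close> is \<open>S\<close>, and its
  \<open>p\<close>-norm is \<open>S powr (1 / p)\<close> because \<open>(q - 1) * p = q\<close>.
  Cancelling this power of \<open>S\<close>, when nonzero, leaves
  \<open>S powr (1 / q) \<le> C\<close>.\<close>

lemma powr_sum_le_of_bilinear:
  fixes b :: "'i \<Rightarrow> real"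
  assumes pq: "p > 1" "q > 1" "1 / p + 1 / q = 1" and b: "\<And>i. i \<in> I \<Longrightarrow> 0 \<le> b i" and C: "C \<ge> 0"
    and bil: "\<And>y. (\<And>i. i \<in> I \<Longrightarrow> 0 \<le> y i) \<Longrightarrow> (\<Sum>i\<in>I. y i * b i) \<le> C * (\<Sum>i\<in>I. y i powr p) powr (1 / p)"
  shows "(\<Sum>i\<in>I. b i powr q) powr (1 / q) \<le> C"
proof -
  define S where "S = (\<Sum>i\<in>I. b i powr q)"
  have S0: "S \<ge> 0" unfolding S_def by (auto intro: sum_nonneg)
  have "(q - 1) * p = q" using pq by (simp add: field_simps)
  have "S = (\<Sum>i\<in>I. b i powr (q - 1) * b i)"
    unfolding S_def
  proof (rule sum.cong[OF refl])
    fix i assume "i \<in> I"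
    show "b i powr q = b i powr (q - 1) * b i"
      using b[OF \<open>i \<in> I\<close>] pq(2) by (cases "b i = 0") (auto simp: powr_diff)
  qed
  also have "\<dots> \<le> C * (\<Sum>i\<in>I. (b i powr (q - 1)) powr p) powr (1 / p)"
    by (rule bil) simp
  also have "\<dots> = C * S powr (1 / p)"
    using \<open>(q - 1) * p = q\<close> by (simp add: S_def powr_powr)
  finally have le: "S \<le> C * S powr (1 / p)" .
  show ?thesis
  proof (cases "S = 0")
    case True
    then show ?thesis using C unfolding S_def[symmetric] by simp
  next
    case False
    with S0 have "S > 0" by simp
    then have "S powr (1 / q) * S powr (1 / p) = S"
      using pq(3) by (simp add: powr_add[symmetric] add.commute)
    with le have "S powr (1 / q) * S powr (1 / p) \<le> C * S powr (1 / p)" by simp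
    then show ?thesis using \<open>S > 0\<close> unfolding S_def[symmetric] by simp
  qed
qed

section \<open>Vector norms and operator norms of real matrices\<close>

lemma mult_mat_vec_index:
  assumes "A \<in> carrier_mat m n" "x \<in> carrier_vec n" "i < m"
  shows "(A *\<^sub>v x) $ i = (\<Sum>j<n. A $$ (i, j) * x $ j)"
  using assms by (auto simp: scalar_prod_def atLeast0LessThan intro!: sum.cong)

lemma mult_mat_index:
  fixes A B :: "'a :: semiring_0 mat"
  assumes "A \<in> carrier_mat m n" "B \<in> carrier_mat n l" "i < m" "j < l"
  shows "(A * B) $$ (i, j) = (\<Sum>k<n. A $$ (i, k) * B $$ (k, j))"
  using assms by (auto simp: scalar_prod_def atLeast0LessThan intro!: sum.cong)

lemma lp_norm_ereal:
  "lp_norm (ereal p) x = (\<Sum>i<dim_vec x. \<bar>x $ i\<bar> powr p) powr (1 / p)"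
  by (simp add: lp_norm_def)

lemma lp_norm_nonneg: "0 \<le> lp_norm (ereal p) x"
  by (simp add: lp_norm_ereal)

lemma lp_norm_zero: "lp_norm (ereal p) (0\<^sub>v n) = 0"
  by (simp add: lp_norm_ereal)

lemma abs_le_lp_norm:
  assumes "p > 0" "j < dim_vec x"
  shows "\<bar>x $ j\<bar> \<le> lp_norm (ereal p) x"
proof -
  have "\<bar>x $ j\<bar> = (\<bar>x $ j\<bar> powr p) powr (1 / p)"
    using assms(1) by (simp add: powr_powr)
  also have "\<dots> \<le> lp_norm (ereal p) x"
    unfolding lp_norm_ereal using assms by (intro powr_mono2 member_le_sum) auto
  finally show ?thesis .
qed

lemma lp_norm_pos:
  assumes "p > 0" "x \<in> carrier_vec n" "x \<noteq> 0\<^sub>v n"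
  shows "0 < lp_norm (ereal p) x"
proof -
  obtain j where "j < n" "x $ j \<noteq> 0"
    using assms(2,3) by (metis carrier_vecD eq_vecI index_zero_vec)
  then show ?thesis
    using abs_le_lp_norm[OF assms(1), of j x] assms(2) by auto
qed

text \<open>Boundedness is what makes the real supremum in \<open>op_norm\<close> an upper bound for
  its quotients. A crude estimate suffices: every coordinate of \<open>Ax\<close> is at most the sum
  of all absolute entries of \<open>A\<close> times the norm of \<open>x\<close>.\<close>

lemma bdd_above_op_norm:
  assumes "p > 0" "r > 0"
  shows "bdd_above ((\<lambda>x. lp_norm (ereal r) (A *\<^sub>v x) / lp_norm (ereal p) x) `
    (carrier_vec (dim_col A) - {0\<^sub>v (dim_col A)}))"
proof -
  let ?m = "dim_row A" and ?n = "dim_col A"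
  define C where "C = (\<Sum>i<?m. \<Sum>j<?n. \<bar>A $$ (i, j)\<bar>)"
  have "lp_norm (ereal r) (A *\<^sub>v x) / lp_norm (ereal p) x \<le> real ?m powr (1 / r) * C"
    if x: "x \<in> carrier_vec ?n - {0\<^sub>v ?n}" for x
  proof -
    let ?N = "lp_norm (ereal p) x"
    have N: "0 < ?N" using x by (intro lp_norm_pos[OF assms(1)]) auto
    have C0: "0 \<le> C" unfolding C_def by (intro sum_nonneg) auto
    have "\<bar>(A *\<^sub>v x) $ i\<bar> \<le> C * ?N" if i: "i < ?m" for i
    proof -
      have "\<bar>(A *\<^sub>v x) $ i\<bar> = \<bar>\<Sum>j<?n. A $$ (i, j) * x $ j\<bar>"
        using x i by (subst mult_mat_vec_index[where m = ?m and n = ?n]) auto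
      also have "\<dots> \<le> (\<Sum>j<?n. \<bar>A $$ (i, j)\<bar> * ?N)"
        using x abs_le_lp_norm[OF assms(1)]
        by (intro order_trans[OF sum_abs] sum_mono) (auto simp: abs_mult intro!: mult_left_mono)
      also have "\<dots> = (\<Sum>j<?n. \<bar>A $$ (i, j)\<bar>) * ?N"
        by (simp add: sum_distrib_right)
      also have "\<dots> \<le> C * ?N"
        unfolding C_def using i N
        by (intro mult_right_mono member_le_sum[where f = "\<lambda>i. \<Sum>j<?n. \<bar>A $$ (i, j)\<bar>"])
          (auto intro: sum_nonneg)
      finally show ?thesis .
    qed
    then have "(\<Sum>i<?m. \<bar>(A *\<^sub>v x) $ i\<bar> powr r) \<le> (\<Sum>i<?m. (C * ?N) powr r)"
      using assms by (intro sum_mono powr_mono2) auto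
    then have "lp_norm (ereal r) (A *\<^sub>v x) \<le> (real ?m * (C * ?N) powr r) powr (1 / r)"
      unfolding lp_norm_ereal[of r] using assms by (intro powr_mono2) (auto intro: sum_nonneg)
    also have "\<dots> = real ?m powr (1 / r) * (C * ?N)"
      using assms C0 N by (simp add: powr_mult powr_powr)
    finally show ?thesis using N by (simp add: divide_le_eq mult_ac)
  qed
  then show ?thesis by (intro bdd_aboveI2)
qed

lemma lp_norm_mult_le_op_norm:
  assumes "p > 0" "r > 0" "x \<in> carrier_vec (dim_col A)"
  shows "lp_norm (ereal r) (A *\<^sub>v x) \<le> op_norm (ereal p) (ereal r) A * lp_norm (ereal p) x"
proof (cases "x = 0\<^sub>v (dim_col A)")
  \<comment> \<open>The zero vector is excluded from the supremum and has to be checked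
    directly.\<close>
  case True
  have "A *\<^sub>v 0\<^sub>v (dim_col A) = 0\<^sub>v (dim_row A)"
    by (intro eq_vecI) auto
  then show ?thesis using True by (simp add: lp_norm_zero)
next
  case False
  then have "lp_norm (ereal r) (A *\<^sub>v x) / lp_norm (ereal p) x \<le> op_norm (ereal p) (ereal r) A"
    unfolding op_norm_def using assms bdd_above_op_norm[OF assms(1,2)] by (intro cSUP_upper) auto
  then show ?thesis
    using lp_norm_pos[OF assms(1,3) False] by (simp add: divide_le_eq)
qed

text \<open>Ensures that the supremum in \<open>op_norm\<close> ranges over a nonempty set.\<close>

lemma carrier_vec_nonzero:
  assumes "0 < n"
  shows "unit_vec n 0 \<in> carrier_vec n - {0\<^sub>v n :: 'a :: zero_neq_one vec}"
proof -
  have "(unit_vec n 0 :: 'a vec) $ 0 \<noteq> 0\<^sub>v n $ 0" using assms by simp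
  then show ?thesis by auto
qed

lemma op_norm_nonneg:
  assumes "p > 0" "r > 0" "0 < dim_col A"
  shows "0 \<le> op_norm (ereal p) (ereal r) A"
proof -
  note u = carrier_vec_nonzero[OF assms(3), where 'a = real]
  have "0 \<le> lp_norm (ereal r) (A *\<^sub>v unit_vec (dim_col A) 0)" by (rule lp_norm_nonneg)
  also have "\<dots> \<le> op_norm (ereal p) (ereal r) A * lp_norm (ereal p) (unit_vec (dim_col A) 0)"
    using u by (intro lp_norm_mult_le_op_norm assms) auto
  finally show ?thesis
    using lp_norm_pos[OF assms(1), of "unit_vec (dim_col A) 0" "dim_col A"] u
    by (auto simp: zero_le_mult_iff)
qed

lemma op_norm_le:
  assumes "0 < dim_col A" "p > 0"
    and "\<And>x. x \<in> carrier_vec (dim_col A) \<Longrightarrow> lp_norm (ereal r) (A *\<^sub>v x) \<le> C * lp_norm (ereal p) x"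
  shows "op_norm (ereal p) (ereal r) A \<le> C"
  unfolding op_norm_def
proof (rule cSUP_least)
  show "carrier_vec (dim_col A) - {0\<^sub>v (dim_col A) :: real vec} \<noteq> {}"
    using carrier_vec_nonzero[OF assms(1), where 'a = real] by blast
  fix x :: "real vec" assume "x \<in> carrier_vec (dim_col A) - {0\<^sub>v (dim_col A)}"
  then have "lp_norm (ereal r) (A *\<^sub>v x) \<le> C * lp_norm (ereal p) x" "0 < lp_norm (ereal p) x"
    using assms(3)[of x] lp_norm_pos[OF assms(2), of x "dim_col A"] by auto
  then show "lp_norm (ereal r) (A *\<^sub>v x) / lp_norm (ereal p) x \<le> C"
    by (simp add: divide_le_eq)
qed

section \<open>A nonnegative symmetric matrix compared with its square\<close>

lemma nonneg_sym_mat_entries: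
  assumes "nonneg_sym_mat n A" "i < n" "j < n"
  shows "0 \<le> A $$ (i, j)" "A $$ (i, j) = A $$ (j, i)"
proof -
  show "0 \<le> A $$ (i, j)" using assms unfolding nonneg_sym_mat_def by blast
  have "transpose_mat A $$ (i, j) = A $$ (j, i)"
    using assms unfolding nonneg_sym_mat_def by (intro index_transpose_mat) auto
  then show "A $$ (i, j) = A $$ (j, i)" using assms unfolding nonneg_sym_mat_def by simp
qed

lemma nonneg_sym_mat_square:
  assumes "nonneg_sym_mat n A"
  shows "nonneg_sym_mat n (A * A)"
proof -
  have A: "A \<in> carrier_mat n n" "transpose_mat A = A" using assms unfolding nonneg_sym_mat_def by auto
  have "0 \<le> (A * A) $$ (i, j)" if "i < n" "j < n" for i j
    unfolding mult_mat_index[OF A(1,1) that]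
    using nonneg_sym_mat_entries(1)[OF assms] that by (auto intro!: sum_nonneg)
  then show ?thesis
    using A transpose_mult[OF A(1,1)] unfolding nonneg_sym_mat_def by (auto intro: mult_carrier_mat)
qed

text \<open>The reciprocals of \<open>r\<close> and \<open>t\<close> are the midpoints of 1/2 with
  those of \<open>p\<close> and \<open>q\<close>, so the norm from \<open>r\<close> to
  \<open>t\<close> is interpolated between the norms from \<open>p\<close> to 2 and from 2 to
  \<open>q\<close>. Averaging also makes \<open>r\<close> and \<open>t\<close> conjugate, as duality
  requires.\<close>

lemma op_norm_power2_le_op_norm_square:
  assumes A: "nonneg_sym_mat n A" and n: "0 < n"
    and pq: "p > 1" "q > 1" "1 / p + 1 / q = 1"
    and rt: "r > 1" "t > 1" "1 / r = 1 / 4 + 1 / (2 * p)" "1 / t = 1 / 4 + 1 / (2 * q)"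
  shows "(op_norm (ereal r) (ereal t) A)\<^sup>2 \<le> op_norm (ereal p) (ereal q) (A * A)"
proof -
  define K where "K = op_norm (ereal p) (ereal q) (A * A)"
  have AC: "A \<in> carrier_mat n n" using A by (simp add: nonneg_sym_mat_def)
  then have dims: "dim_row A = n" "dim_col A = n" by auto
  note ent = nonneg_sym_mat_entries[OF A]
  have K0: "0 \<le> K"
    unfolding K_def using pq n dims by (intro op_norm_nonneg) auto
  have "1 / r + 1 / t = 1 / 2 + (1 / p + 1 / q) / 2"
    unfolding rt(3,4) by (simp add: field_simps)
  then have rt1: "1 / r + 1 / t = 1" using pq(3) by simp
  \<comment> \<open>For nonnegative \<open>z\<close> the absolute values in both norms disappear,
    since \<open>A * A\<close> is entrywise nonnegative as well.\<close>
  have square: "(\<Sum>i<n. (\<Sum>j<n. A $$ (i, j) * z j)\<^sup>2) \<le> K * ((\<Sum>i<n. z i powr p) powr (1 / p))\<^sup>2"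
    if z: "\<And>i. i < n \<Longrightarrow> 0 \<le> z i" for z
  proof (rule square_bound_of_symmetric_kernel[where q = q])
    have "lp_norm (ereal q) ((A * A) *\<^sub>v vec n z) \<le> K * lp_norm (ereal p) (vec n z)"
      unfolding K_def using pq dims by (intro lp_norm_mult_le_op_norm) auto
    moreover have "lp_norm (ereal p) (vec n z) = (\<Sum>i<n. z i powr p) powr (1 / p)"
      using z by (simp add: lp_norm_ereal)
    moreover have "((A * A) *\<^sub>v vec n z) $ i = (\<Sum>j<n. (\<Sum>k<n. A $$ (i, k) * A $$ (k, j)) * z j)"
      if "i < n" for i
      using that AC mult_mat_index[OF AC AC]
      by (subst mult_mat_vec_index[where m = n and n = n]) (auto simp del: index_mult_mat)
    moreover have "0 \<le> (\<Sum>j<n. (\<Sum>k<n. A $$ (i, k) * A $$ (k, j)) * z j)" if "i < n" for i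
      using that ent(1) z by (auto intro!: sum_nonneg mult_nonneg_nonneg)
    ultimately show "(\<Sum>i<n. (\<Sum>j<n. (\<Sum>k<n. A $$ (i, k) * A $$ (k, j)) * z j) powr q) powr (1 / q)
        \<le> K * (\<Sum>i<n. z i powr p) powr (1 / p)"
      using dims by (simp add: lp_norm_ereal del: index_mult_mat_vec)
  qed (use pq ent z in auto)
  have "op_norm (ereal r) (ereal t) A \<le> sqrt K"
  proof (rule op_norm_le)
    fix x :: "real vec" assume "x \<in> carrier_vec (dim_col A)"
    then have x: "x \<in> carrier_vec n" using dims by simp
    let ?b = "\<lambda>i. \<Sum>j<n. A $$ (i, j) * \<bar>x $ j\<bar>"
    have "lp_norm (ereal t) (A *\<^sub>v x) = (\<Sum>i<n. \<bar>(A *\<^sub>v x) $ i\<bar> powr t) powr (1 / t)"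
      using dims by (simp add: lp_norm_ereal)
    \<comment> \<open>Since \<open>A\<close> is nonnegative, passing to absolute values of
      \<open>x\<close> only enlarges the image and leaves the norm of \<open>x\<close> unchanged;
      interpolation is available for nonnegative vectors.\<close>
    also have "\<dots> \<le> (\<Sum>i<n. ?b i powr t) powr (1 / t)"
    proof (intro powr_mono2 sum_mono)
      fix i assume "i \<in> {..<n}"
      then show "\<bar>(A *\<^sub>v x) $ i\<bar> \<le> ?b i"
        using ent(1)
        by (subst mult_mat_vec_index[OF AC x]) (auto intro!: order_trans[OF sum_abs] sum_mono simp: abs_mult)
    qed (use rt(2) in \<open>auto intro: sum_nonneg\<close>)
    also have "\<dots> \<le> sqrt K * lp_norm (ereal r) x"
    \<comment> \<open>By duality it is enough to pair with nonnegative \<open>y\<close>, and this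
      bilinear form is controlled by interpolation.\<close>
    proof (rule powr_sum_le_of_bilinear[where p = r])
      fix y :: "nat \<Rightarrow> real" assume y: "\<And>i. i \<in> {..<n} \<Longrightarrow> 0 \<le> y i"
      have "(\<Sum>i<n. y i * ?b i)
          \<le> sqrt K * (\<Sum>i<n. \<bar>x $ i\<bar> powr r) powr (1 / r) * (\<Sum>i<n. y i powr r) powr (1 / r)"
        using pq rt K0 ent square y
        by (intro bilinear_interpolation[where p = p]) auto
      then show "(\<Sum>i<n. y i * ?b i) \<le> sqrt K * lp_norm (ereal r) x * (\<Sum>i<n. y i powr r) powr (1 / r)"
        using x by (simp add: lp_norm_ereal)
    qed (use rt rt1 ent K0 lp_norm_nonneg in \<open>auto intro!: sum_nonneg mult_nonneg_nonneg\<close>)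
    finally show "lp_norm (ereal t) (A *\<^sub>v x) \<le> sqrt K * lp_norm (ereal r) x" .
  qed (use n dims rt in auto)
  moreover have "0 \<le> op_norm (ereal r) (ereal t) A"
    using rt n dims by (intro op_norm_nonneg) auto
  ultimately have "(op_norm (ereal r) (ereal t) A)\<^sup>2 \<le> (sqrt K)\<^sup>2"
    by (intro power_mono)
  then show ?thesis using K0 by (simp add: K_def)
qed

section \<open>Subdivisions and their homomorphism counts\<close>

lemma simple_graph_edge:
  assumes "simple_graph G" "e \<in> gedges G"
  obtains u v where "u \<in> gverts G" "v \<in> gverts G" "u \<noteq> v" "e = {u, v}"
  using assms unfolding simple_graph_def by blast

lemma finite_gedges:
  assumes "simple_graph G"
  shows "finite (gedges G)"
proof (rule finite_subset)
  show "gedges G \<subseteq> Pow (gverts G)" using assms by (auto elim!: simple_graph_edge)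
  show "finite (Pow (gverts G))" using assms by (simp add: simple_graph_def)
qed

text \<open>The two sides are the original vertices and the new ones.\<close>

lemma bipartite_subdivision:
  assumes "simple_graph H"
  shows "bipartite_graph (subdivision H)"
proof -
  have 1: "\<exists>x\<in>Inl ` gverts H. \<exists>y\<in>Inr ` gedges H. d = {x, y}" if "d \<in> gedges (subdivision H)" for d
    using that assms by (auto simp: subdivision_def elim!: simple_graph_edge)
  have V: "gverts (subdivision H) = Inl ` gverts H \<union> Inr ` gedges H"
    by (auto simp: subdivision_def)
  have "simple_graph (subdivision H)"
    unfolding simple_graph_def
  proof (intro conjI ballI)
    show "finite (gverts (subdivision H))" "gverts (subdivision H) \<noteq> {}"
      using assms finite_gedges[OF assms] by (auto simp: V simple_graph_def)
    fix d assume "d \<in> gedges (subdivision H)"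
    from 1[OF this] show "\<exists>u\<in>gverts (subdivision H). \<exists>v\<in>gverts (subdivision H). u \<noteq> v \<and> d = {u, v}"
      unfolding V by blast
  qed
  moreover have "Inl ` gverts H \<inter> Inr ` gedges H = ({} :: ('a + 'a set) set)" by auto
  ultimately show ?thesis
    unfolding bipartite_graph_def
    by (intro conjI exI[of _ "Inl ` gverts H"] exI[of _ "Inr ` gedges H"] ballI 1 V[symmetric])
qed

lemma num_verts_subdivision:
  assumes "simple_graph H"
  shows "num_verts (subdivision H) = num_verts H + num_edges H"
  using assms finite_gedges[OF assms] by (simp add: subdivision_def simple_graph_def card_Plus)

text \<open>New edges correspond to incidences of an edge of \<open>H\<close> with one of its
  endpoints, and every edge of a simple graph has two endpoints.\<close>

lemma num_edges_subdivision:
  assumes "simple_graph H"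
  shows "num_edges (subdivision H) = 2 * num_edges H"
proof -
  let ?F = "\<lambda>(d, u). {Inl u, Inr d} :: ('a + 'a set) set"
  have 2: "finite d \<and> card d = 2" if "d \<in> gedges H" for d
    using assms that by (auto elim!: simple_graph_edge)
  have "gedges (subdivision H) = ?F ` (SIGMA d:gedges H. d)"
    by (auto simp: subdivision_def)
  moreover have "inj_on ?F (SIGMA d:gedges H. d)"
    by (auto simp: inj_on_def doubleton_eq_iff)
  ultimately have "num_edges (subdivision H) = card (SIGMA d:gedges H. d)"
    by (simp add: card_image)
  also have "\<dots> = 2 * num_edges H"
    using 2 finite_gedges[OF assms] by simp
  finally show ?thesis .
qed

text \<open>No two original vertices are adjacent in the subdivision, so \<phi> may be any map on
  them. Once \<phi> is fixed, the new vertices choose their images independently, each in the common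
  neighbourhood of the images of the endpoints of its edge.\<close>

lemma hom_count_subdivision:
  assumes H: "simple_graph H" and G: "simple_graph G"
  shows "hom_count (subdivision H) G = (\<Sum>\<phi>\<in>gverts H \<rightarrow>\<^sub>E gverts G.
    \<Prod>d\<in>gedges H. card {w \<in> gverts G. \<forall>u\<in>d. {\<phi> u, w} \<in> gedges G})"
proof -
  let ?V = "gverts H" and ?E = "gedges H"
  let ?S = "\<lambda>\<phi> d. {w \<in> gverts G. \<forall>u\<in>d. {\<phi> u, w} \<in> gedges G}"
  have fin: "finite ?V" "finite ?E" "finite (gverts G)"
    using H G finite_gedges by (auto simp: simple_graph_def)
  have edges: "{a, b} \<in> gedges (subdivision H) \<longleftrightarrow>
      (\<exists>u d. d \<in> ?E \<and> u \<in> d \<and> (a = Inl u \<and> b = Inr d \<or> a = Inr d \<and> b = Inl u))" for a b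
    by (auto simp: subdivision_def doubleton_eq_iff)
  have "bij_betw (\<lambda>h. (h \<circ> Inl, h \<circ> Inr)) (graph_homs (subdivision H) G)
      (SIGMA \<phi>:?V \<rightarrow>\<^sub>E gverts G. PiE ?E (?S \<phi>))"
  proof (rule bij_betwI[where g = "\<lambda>(\<phi>, \<psi>). case_sum \<phi> \<psi>"])
    show "(\<lambda>h. (h \<circ> Inl, h \<circ> Inr)) \<in> graph_homs (subdivision H) G \<rightarrow>
        (SIGMA \<phi>:?V \<rightarrow>\<^sub>E gverts G. PiE ?E (?S \<phi>))"
    proof
      fix h assume "h \<in> graph_homs (subdivision H) G"
      then have hV: "h \<in> ?V <+> ?E \<rightarrow>\<^sub>E gverts G"
        and hE: "\<And>a b. {a, b} \<in> gedges (subdivision H) \<Longrightarrow> {h a, h b} \<in> gedges G"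
        by (auto simp: graph_homs_def subdivision_def)
      have "{h (Inl u), h (Inr d)} \<in> gedges G" if "d \<in> ?E" "u \<in> d" for u d
        using that by (intro hE) (auto simp: edges)
      \<comment> \<open>Both components must inherit the default value outside their domains, so
        that they lie in the extensional function spaces.\<close>
      moreover have "h (Inl u) = undefined" if "u \<notin> ?V" for u
        using that by (intro PiE_arb[OF hV]) auto
      moreover have "h (Inr d) = undefined" if "d \<notin> ?E" for d
        using that by (intro PiE_arb[OF hV]) auto
      moreover have "\<And>u. u \<in> ?V \<Longrightarrow> h (Inl u) \<in> gverts G" "\<And>d. d \<in> ?E \<Longrightarrow> h (Inr d) \<in> gverts G"
        using PiE_mem[OF hV] by auto
      ultimately show "(h \<circ> Inl, h \<circ> Inr) \<in> (SIGMA \<phi>:?V \<rightarrow>\<^sub>E gverts G. PiE ?E (?S \<phi>))"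
        by (simp add: PiE_iff extensional_def)
    qed
    show "(\<lambda>(\<phi>, \<psi>). case_sum \<phi> \<psi>) \<in> (SIGMA \<phi>:?V \<rightarrow>\<^sub>E gverts G. PiE ?E (?S \<phi>)) \<rightarrow>
        graph_homs (subdivision H) G"
    proof (clarify, rename_tac \<phi> \<psi>)
      fix \<phi> \<psi> assume \<phi>: "\<phi> \<in> ?V \<rightarrow>\<^sub>E gverts G" and \<psi>: "\<psi> \<in> PiE ?E (?S \<phi>)"
      have "case_sum \<phi> \<psi> \<in> ?V <+> ?E \<rightarrow>\<^sub>E gverts G"
        using \<phi> \<psi> by (auto simp: PiE_iff extensional_def Plus_def split: sum.split)
      moreover have "{\<phi> u, \<psi> d} \<in> gedges G" if "d \<in> ?E" "u \<in> d" for u d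
        using \<psi> that by (auto simp: PiE_iff)
      then have "{case_sum \<phi> \<psi> a, case_sum \<phi> \<psi> b} \<in> gedges G" if "{a, b} \<in> gedges (subdivision H)" for a b
        using that unfolding edges by (auto simp: insert_commute)
      ultimately show "case_sum \<phi> \<psi> \<in> graph_homs (subdivision H) G"
        by (simp add: graph_homs_def subdivision_def)
    qed
  next
    show "(case (h \<circ> Inl, h \<circ> Inr) of (\<phi>, \<psi>) \<Rightarrow> case_sum \<phi> \<psi>) = h" for h :: "'a + 'a set \<Rightarrow> 'b"
      by (simp add: fun_eq_iff split: sum.split)
    show "((case z of (\<phi>, \<psi>) \<Rightarrow> case_sum \<phi> \<psi>) \<circ> Inl, (case z of (\<phi>, \<psi>) \<Rightarrow> case_sum \<phi> \<psi>) \<circ> Inr) = z"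
      for z :: "('a \<Rightarrow> 'b) \<times> ('a set \<Rightarrow> 'b)"
      by (cases z) (simp add: fun_eq_iff)
  qed
  then have "hom_count (subdivision H) G = card (SIGMA \<phi>:?V \<rightarrow>\<^sub>E gverts G. PiE ?E (?S \<phi>))"
    unfolding hom_count_def by (rule bij_betw_same_card)
  also have "\<dots> = (\<Sum>\<phi>\<in>?V \<rightarrow>\<^sub>E gverts G. card (PiE ?E (?S \<phi>)))"
    using fin by (intro card_SigmaI ballI finite_PiE) auto
  also have "\<dots> = (\<Sum>\<phi>\<in>?V \<rightarrow>\<^sub>E gverts G. \<Prod>d\<in>?E. card (?S \<phi> d))"
    using fin by (simp add: card_PiE)
  finally show ?thesis .
qed

text \<open>Transports sums over maps into the vertices of \<open>G\<close> to sums over maps into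
  matrix indices; \<open>restrict\<close> keeps the composites extensional.\<close>

lemma bij_betw_PiE_compose:
  assumes "bij_betw f A B"
  shows "bij_betw (\<lambda>\<phi>. restrict (f \<circ> \<phi>) V) (V \<rightarrow>\<^sub>E A) (V \<rightarrow>\<^sub>E B)"
proof (rule bij_betwI[where g = "\<lambda>\<phi>. restrict (inv_into A f \<circ> \<phi>) V"])
  show "(\<lambda>\<phi>. restrict (f \<circ> \<phi>) V) \<in> (V \<rightarrow>\<^sub>E A) \<rightarrow> (V \<rightarrow>\<^sub>E B)"
    using bij_betw_apply[OF assms] by (auto simp: PiE_iff)
  show "(\<lambda>\<phi>. restrict (inv_into A f \<circ> \<phi>) V) \<in> (V \<rightarrow>\<^sub>E B) \<rightarrow> (V \<rightarrow>\<^sub>E A)"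
    using bij_betw_apply[OF bij_betw_inv_into[OF assms]] by (auto simp: PiE_iff)
  fix \<phi> assume "\<phi> \<in> V \<rightarrow>\<^sub>E A"
  then show "restrict (inv_into A f \<circ> restrict (f \<circ> \<phi>) V) V = \<phi>"
    using bij_betw_inv_into_left[OF assms] by (auto simp: fun_eq_iff PiE_iff extensional_def)
next
  fix \<phi> assume "\<phi> \<in> V \<rightarrow>\<^sub>E B"
  then show "restrict (f \<circ> restrict (inv_into A f \<circ> \<phi>) V) V = \<phi>"
    using bij_betw_inv_into_right[OF assms] by (auto simp: fun_eq_iff PiE_iff extensional_def)
qed

lemma adjacency_matrix_nonneg_sym:
  assumes "adjacency_matrix G A"
  shows "nonneg_sym_mat (num_verts G) A"
  using assms unfolding adjacency_matrix_def nonneg_sym_mat_def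
  by (auto simp: insert_commute)

text \<open>An entry of \<open>A * A\<close> is the number of common neighbours of the two vertices
  it refers to, so each product of common neighbourhood sizes is the weight of the corresponding map
  in \<open>hom_mat H (A * A)\<close>.\<close>

lemma hom_count_subdivision_eq_hom_mat:
  assumes H: "simple_graph H" and G: "simple_graph G" and A: "adjacency_matrix G A"
  shows "real (hom_count (subdivision H) G) = hom_mat H (A * A)"
proof -
  define n where "n = num_verts G"
  obtain f where f: "bij_betw f {..<n} (gverts G)"
    and Af: "A = mat n n (\<lambda>(i, j). if {f i, f j} \<in> gedges G then 1 else 0)"
    using A unfolding adjacency_matrix_def n_def by blast
  have AC: "A \<in> carrier_mat n n" unfolding Af by simp
  have AA: "nonneg_sym_mat n (A * A)"
    unfolding n_def by (intro nonneg_sym_mat_square adjacency_matrix_nonneg_sym A)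
  let ?S = "\<lambda>\<phi> d. {w \<in> gverts G. \<forall>u\<in>d. {\<phi> u, w} \<in> gedges G}"
  have weight: "real (card (?S (restrict (f \<circ> \<phi>) (gverts H)) d)) = edge_weight (A * A) \<phi> d"
    if \<phi>: "\<phi> \<in> gverts H \<rightarrow>\<^sub>E {..<n}" and d: "d \<in> gedges H" for \<phi> d
  proof -
    obtain u v where uv: "u \<in> gverts H" "v \<in> gverts H" "d = {u, v}"
      using simple_graph_edge[OF H d] by metis
    then have less: "\<phi> u < n" "\<phi> v < n" using \<phi> by auto
    let ?T = "{k \<in> {..<n}. {f (\<phi> u), f k} \<in> gedges G \<and> {f (\<phi> v), f k} \<in> gedges G}"
    have "edge_weight (A * A) \<phi> d = (A * A) $$ (\<phi> u, \<phi> v)"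
      unfolding uv(3) using AA less by (intro edge_weight_eq) (auto simp: nonneg_sym_mat_def)
    also have "\<dots> = (\<Sum>k<n. A $$ (\<phi> u, k) * A $$ (k, \<phi> v))"
      by (rule mult_mat_index[OF AC AC less])
    also have "\<dots> = (\<Sum>k<n. if {f (\<phi> u), f k} \<in> gedges G \<and> {f (\<phi> v), f k} \<in> gedges G then 1 else 0)"
      using less by (intro sum.cong) (auto simp: Af insert_commute)
    also have "\<dots> = real (card ?T)"
      by (simp add: sum.If_cases Int_def)
    \<comment> \<open>The enumeration \<open>f\<close> is injective, so counting indices and
      counting vertices agree.\<close>
    also have "card ?T = card (f ` ?T)"
      using f by (intro card_image[symmetric]) (auto simp: bij_betw_def inj_on_def)
    also have "f ` ?T = ?S (restrict (f \<circ> \<phi>) (gverts H)) d"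
      using uv bij_betw_imp_surj_on[OF f] by auto
    finally show ?thesis by simp
  qed
  have "real (hom_count (subdivision H) G) =
      (\<Sum>\<phi>\<in>gverts H \<rightarrow>\<^sub>E gverts G. \<Prod>d\<in>gedges H. real (card (?S \<phi> d)))"
    unfolding hom_count_subdivision[OF H G] by simp
  also have "\<dots> = (\<Sum>\<phi>\<in>gverts H \<rightarrow>\<^sub>E {..<n}. \<Prod>d\<in>gedges H.
      real (card (?S (restrict (f \<circ> \<phi>) (gverts H)) d)))"
    by (rule sum.reindex_bij_betw[OF bij_betw_PiE_compose[OF f], symmetric])
  also have "\<dots> = hom_mat H (A * A)"
    using AC weight unfolding hom_mat_def by (auto intro!: sum.cong prod.cong)
  finally show ?thesis .
qed

theorem proposition2p5:
  fixes H :: "'a ugraph" and v e :: nat and s s' \<sigma> \<sigma>' :: real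
  assumes "bipartite_graph H"
    and "v = num_verts H" and "e = num_edges H" and "v \<le> e"
    and "s = 2 * real e / real v" and "s' = 2 * real e / (2 * real e - real v)"
    and "\<And>n W. n \<ge> 1 \<Longrightarrow> nonneg_sym_mat n W \<Longrightarrow> hom_mat H W \<ge> op_norm (ereal s') (ereal s) W ^ e"
    and "\<sigma> = 4 * real e / (real v + real e)" and "\<sigma>' = 4 * real e / (3 * real e - real v)"
  shows "opnorm_sidorenko_certificate TYPE('b) (subdivision H) \<and>
    (\<forall>(G :: 'b ugraph) A. simple_graph G \<longrightarrow> adjacency_matrix G A \<longrightarrow>
       real (hom_count (subdivision H) G) \<ge> op_norm (ereal \<sigma>') (ereal \<sigma>) A ^ (2 * e))"
proof -
  have H: "simple_graph H" using assms(1) by (simp add: bipartite_graph_def)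
  then have "0 < v" using assms(2) by (simp add: simple_graph_def card_gt_0_iff)
  then have ve: "0 < real v" "0 < real e" "real v \<le> real e" using assms(4) by auto
  \<comment> \<open>With \<open>1 / s = v / (2 * e)\<close> one has
    \<open>1 / \<sigma> = (v + e) / (4 * e) = 1 / 4 + 1 / (2 * s)\<close>, and likewise for the
    primed exponents. The bounds come from \<open>0 < v \<le> e\<close>.\<close>
  have conj: "s' > 1" "s > 1" "1 / s' + 1 / s = 1" "\<sigma>' > 1" "\<sigma> > 1"
    "1 / \<sigma>' = 1 / 4 + 1 / (2 * s')" "1 / \<sigma> = 1 / 4 + 1 / (2 * s)"
    unfolding assms(5,6,8,9) using ve by (auto simp: field_simps)
  have bound: "real (hom_count (subdivision H) G) \<ge> op_norm (ereal \<sigma>') (ereal \<sigma>) A ^ (2 * e)"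
    if G: "simple_graph G" and A: "adjacency_matrix G A" for G :: "'b ugraph" and A
  proof -
    have n: "0 < num_verts G" using G by (simp add: simple_graph_def card_gt_0_iff)
    note AW = adjacency_matrix_nonneg_sym[OF A]
    have "op_norm (ereal \<sigma>') (ereal \<sigma>) A ^ (2 * e) = ((op_norm (ereal \<sigma>') (ereal \<sigma>) A)\<^sup>2) ^ e"
      by (rule power_mult)
    also have "\<dots> \<le> op_norm (ereal s') (ereal s) (A * A) ^ e"
      by (intro power_mono op_norm_power2_le_op_norm_square[OF AW n conj]) simp
    \<comment> \<open>The hypothesis on \<open>H\<close> is applied to the weighted matrix
      \<open>A * A\<close>, which is in general not an adjacency matrix.\<close>
    also have "\<dots> \<le> hom_mat H (A * A)"
      using n by (intro assms(7)[OF _ nonneg_sym_mat_square[OF AW]]) simp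
    also have "\<dots> = real (hom_count (subdivision H) G)"
      by (rule hom_count_subdivision_eq_hom_mat[OF H G A, symmetric])
    finally show ?thesis .
  qed
  have num: "num_verts (subdivision H) = v + e" "num_edges (subdivision H) = 2 * e"
    using num_verts_subdivision[OF H] num_edges_subdivision[OF H] assms(2,3) by auto
  \<comment> \<open>The exponents that the certificate prescribes for a graph with
    \<open>v + e\<close> vertices and \<open>2 * e\<close> edges are \<sigma> and \<sigma>'.\<close>
  have "2 * real (2 * e) / real (v + e) = \<sigma>" "2 * real (2 * e) / (2 * real (2 * e) - real (v + e)) = \<sigma>'"
    unfolding assms(8,9) by (simp_all add: algebra_simps)
  then have "opnorm_sidorenko_certificate TYPE('b) (subdivision H)"
    unfolding opnorm_sidorenko_certificate_def Let_def num
    using bipartite_subdivision[OF H] assms(4) bound by simp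
  then show ?thesis using bound by blast
qed

end
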